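(* Let $\xi=(\xi_t)_{0\le t\le T}$ be a progressively measurable target process with $\xi_0\in L^2(\mathbb P)$ and $\mathbb E\int_0^T\xi_t^2\,dt<\infty$, and let $x\in\mathbb R$. For every $0<\kappa\le T^2/2$, $$v(\kappa)\ge\frac1{12}\,\omega_\xi\!\left(\sqrt{2\kappa}\right)-\frac{\sqrt2}{4}\sqrt\kappa\,\mathbb E\bigl[(x-\xi_0)^2\bigr].$$ In particular, if $x=\xi_0$ almost surely, then $$\frac1{12}\,\omega_\xi\!\left(\sqrt{2\kappa}\right)\le v(\kappa)\le\frac1{\sqrt\kappa}\int_0^\infty e^{-h/\sqrt\kappa}\,\omega_\xi(h)\,dh,\qquad 0<\kappa\le T^2/2.$$ If $x=\xi_0$ almost surely and $c h^\alpha\le\omega_\xi(h)\le Ch^\alpha$ for all $0<h\le T$, for some $c,C,\alpha>0$, then $$\frac{c\,2^{\alpha/2}}{12}\,\kappa^{\alpha/2}\le v(\kappa)\le C\,\Gamma(\alpha+1)\,\kappa^{\alpha/2},\qquad 0<\kappa\le T^2/2,$$ and thus $v(\kappa)\asymp\kappa^{\alpha/2}\asymp\omega_\xi(\sqrt\kappa)$ as $\kappa\downarrow0$.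
   Context: Fix $T>0$, a filtered probability space $(\Omega,\mathcal F,(\mathcal F_t)_{0\le t\le T},\mathbb P)$ satisfying the usual conditions, and $x\in\mathbb R$. Let $\mathcal U$ be the set of progressively measurable processes $u=(u_t)_{0\le t\le T}$ with $\mathbb E\int_0^T u_t^2\,dt<\infty$, and for $u\in\mathcal U$ let $X^u_t=x+\int_0^t u_s\,ds$. For $\kappa\ge 0$ set $$J_\kappa(u)=\mathbb E\Big[\tfrac12\int_0^T(X^u_t-\xi_t)^2\,dt+\tfrac{\kappa}{2}\int_0^Tu_t^2\,dt\Big],\qquad v(\kappa)=\inf_{u\in\mathcal U}J_\kappa(u).$$ Further, $\omega_\xi(h)=\mathbb E\int_0^T|\xi_t-\xi_{(t-h)^+}|^2\,dt$ for $h>0$, where $(t-h)^+=\max\{t-h,0\}$. $\Gamma$ is the Gamma function. $f(\kappa)\asymp g(\kappa)$ as $\kappa\downarrow0$ means that $f/g$ is bounded above and below by positive constants for all sufficiently small $\kappa>0$. *)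

theory Defs
  imports "HOL-Probability.Probability"
begin

text \<open>
  Processes on the time interval \<open>[0, T]\<close> are functions \<open>real \<Rightarrow> 'a \<Rightarrow> real\<close>, time first; their values
  outside \<open>[0, T]\<close> are never used. Expectations of nonnegative quantities are \<open>ennreal\<close>-valued,
  so no integrability convention enters.
\<close>

locale usual_filtered_prob_space = prob_space M + complete_measure M
  for M :: "'a measure" and F :: "real \<Rightarrow> 'a measure" and T :: real +
  assumes T_pos: "0 < T"
    and subalgebra_F: "\<And>t. 0 \<le> t \<Longrightarrow> t \<le> T \<Longrightarrow> subalgebra M (F t)"
    and sets_F_mono: "\<And>s t. 0 \<le> s \<Longrightarrow> s \<le> t \<Longrightarrow> t \<le> T \<Longrightarrow> sets (F s) \<subseteq> sets (F t)"
    and null_sets_F: "null_sets M \<subseteq> sets (F 0)"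
    and right_continuous_F: "\<And>t. 0 \<le> t \<Longrightarrow> t < T \<Longrightarrow> sets (F t) = (\<Inter>s\<in>{t<..T}. sets (F s))"

definition progressively_measurable ::
  "(real \<Rightarrow> 'a measure) \<Rightarrow> real \<Rightarrow> (real \<Rightarrow> 'a \<Rightarrow> real) \<Rightarrow> bool"
  where "progressively_measurable F T Y \<longleftrightarrow>
    (\<forall>t\<in>{0..T}. (\<lambda>(s, w). Y s w) \<in> borel_measurable (restrict_space borel {0..t} \<Otimes>\<^sub>M F t))"

definition controls ::
  "'a measure \<Rightarrow> (real \<Rightarrow> 'a measure) \<Rightarrow> real \<Rightarrow> (real \<Rightarrow> 'a \<Rightarrow> real) set"
  where "controls M F T = {u. progressively_measurable F T u \<and>
    (\<integral>\<^sup>+w. (\<integral>\<^sup>+t\<in>{0..T}. ennreal ((u t w)\<^sup>2) \<partial>lborel) \<partial>M) < \<infinity>}"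

text \<open>
  The Lebesgue integral is \<open>0\<close> by convention on paths that are not integrable; for a control
  these form a null set.
\<close>

definition controlled_state :: "real \<Rightarrow> (real \<Rightarrow> 'a \<Rightarrow> real) \<Rightarrow> real \<Rightarrow> 'a \<Rightarrow> real"
  where "controlled_state x u t w = x + (LINT s:{0..t}|lborel. u s w)"

definition tracking_cost ::
  "'a measure \<Rightarrow> real \<Rightarrow> (real \<Rightarrow> 'a \<Rightarrow> real) \<Rightarrow> real \<Rightarrow> real \<Rightarrow> (real \<Rightarrow> 'a \<Rightarrow> real) \<Rightarrow> ennreal"
  where "tracking_cost M T \<xi> x \<kappa> u =
    (\<integral>\<^sup>+w. (ennreal (1 / 2) * (\<integral>\<^sup>+t\<in>{0..T}. ennreal ((controlled_state x u t w - \<xi> t w)\<^sup>2) \<partial>lborel)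
         + ennreal (\<kappa> / 2) * (\<integral>\<^sup>+t\<in>{0..T}. ennreal ((u t w)\<^sup>2) \<partial>lborel)) \<partial>M)"

definition tracking_value ::
  "'a measure \<Rightarrow> (real \<Rightarrow> 'a measure) \<Rightarrow> real \<Rightarrow> (real \<Rightarrow> 'a \<Rightarrow> real) \<Rightarrow> real \<Rightarrow> real \<Rightarrow> ennreal"
  where "tracking_value M F T \<xi> x \<kappa> = (INF u\<in>controls M F T. tracking_cost M T \<xi> x \<kappa> u)"

definition L2_modulus ::
  "'a measure \<Rightarrow> real \<Rightarrow> (real \<Rightarrow> 'a \<Rightarrow> real) \<Rightarrow> real \<Rightarrow> ennreal"
  where "L2_modulus M T \<xi> h =
    (\<integral>\<^sup>+w. (\<integral>\<^sup>+t\<in>{0..T}. ennreal (\<bar>\<xi> t w - \<xi> (max (t - h) 0) w\<bar>\<^sup>2) \<partial>lborel) \<partial>M)"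

text \<open>
  The lower bound \<open>a > 0\<close> excludes the conventional values \<open>0 / 0 = 0\<close> and \<open>\<infinity> / \<infinity> = 0\<close>
  of division on \<open>ennreal\<close>.
\<close>

definition asymp_at_0 :: "(real \<Rightarrow> ennreal) \<Rightarrow> (real \<Rightarrow> ennreal) \<Rightarrow> bool"
  where "asymp_at_0 f g \<longleftrightarrow> (\<exists>a b::real. 0 < a \<and> 0 < b \<and>
    (\<forall>\<^sub>F \<kappa> in at_right 0. ennreal a \<le> f \<kappa> / g \<kappa> \<and> f \<kappa> / g \<kappa> \<le> ennreal b))"

end

theory Submission
  imports Defs
begin

text \<open>
  Both bounds hold path by path. For the lower bound, put \<open>h = sqrt (2 * \<kappa>)\<close> and split
  \<open>\<xi> t - \<xi> (t - h)\<close> into \<open>(\<xi> t - X t) + (X t - X (t - h)) + (X (t - h) - \<xi> (t - h))\<close>. The outer terms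
  are controlled by the tracking error and, on \<open>t < h\<close>, by the initial gap; the middle one by
  Cauchy--Schwarz and the energy of the control.

  For the upper bound, follow the feedback \<open>u = (\<xi> - X) / sqrt \<kappa>\<close>. Its state is the exponential moving
  average of the past of \<open>\<xi>\<close>, both parts of its cost are equal, and Jensen's inequality for
  the exponential density bounds the squared error by the average of \<open>\<omega>\<^sub>\<xi>(h)\<close>.
\<close>

text \<open>The constants come from balancing. Squaring a sum of three terms costs a factor 3, and
  the tracking error occurs twice, so each path satisfies: modulus at most 6 * error + 3 * h^2 *
  energy + 3 * h * gap. The weights 1/2 and \<kappa>/2 of the cost are in the proportion of 6 and 3
  * h^2 exactly when h^2 = 2 * \<kappa>, and the common factor is then 12. For a feedback of rate l,
  the two parts of the cost agree when \<kappa> * l^2 = 1.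

  The delay (t - h)^+ amounts to extending a path to negative times by its initial value. Smoothing
  that starts at this value is exactly the exponential average of the extended path; this is where x
  = \<xi>_0 enters the upper bound.

  The feedback is not known in advance to have finite energy. Its expected energy is at most l^2
  times the claimed upper bound: either that bound is infinite and there is nothing to show, or the
  feedback is admissible.\<close>

section \<open>Square-integrable paths\<close>

text \<open>Cauchy--Schwarz with the weight split as \<open>sqrt k * sqrt k\<close>. It serves both
  bounds: an indicator as weight controls increments of the state, a probability density gives
  Jensen's inequality for squares. Without integrability the left side is 0 by convention.\<close>

lemma square_integral_mult_le:
  fixes k g :: "'b \<Rightarrow> real"
  assumes [measurable]: "k \<in> borel_measurable N" "g \<in> borel_measurable N"
    and k_nonneg: "\<And>s. 0 \<le> k s"
  shows "ennreal ((\<integral>s. k s * g s \<partial>N)\<^sup>2)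
    \<le> (\<integral>\<^sup>+s. ennreal (k s) \<partial>N) * (\<integral>\<^sup>+s. ennreal (k s * (g s)\<^sup>2) \<partial>N)"
proof (cases "integrable N (\<lambda>s. k s * g s)")
  case False
  then show ?thesis by (simp add: not_integrable_integral_eq)
next
  case True
  have "ennreal ((\<integral>s. k s * g s \<partial>N)\<^sup>2) = (ennreal \<bar>\<integral>s. k s * g s \<partial>N\<bar>)\<^sup>2"
    by (simp add: ennreal_power)
  also have "\<dots> \<le> (\<integral>\<^sup>+s. ennreal \<bar>k s * g s\<bar> \<partial>N)\<^sup>2"
    using integral_norm_bound_ennreal[OF True] by (intro power_mono) auto
  also have "\<dots> = (\<integral>\<^sup>+s. ennreal (sqrt (k s)) * ennreal (sqrt (k s) * \<bar>g s\<bar>) \<partial>N)\<^sup>2"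
    using k_nonneg by (simp flip: ennreal_mult mult.assoc add: abs_mult)
  also have "\<dots> \<le> (\<integral>\<^sup>+s. (ennreal (sqrt (k s)))\<^sup>2 \<partial>N) * (\<integral>\<^sup>+s. (ennreal (sqrt (k s) * \<bar>g s\<bar>))\<^sup>2 \<partial>N)"
    by (rule Cauchy_Schwarz_nn_integral) measurable
  also have "\<dots> = (\<integral>\<^sup>+s. ennreal (k s) \<partial>N) * (\<integral>\<^sup>+s. ennreal (k s * (g s)\<^sup>2) \<partial>N)"
    using k_nonneg by (simp add: ennreal_power power_mult_distrib)
  finally show ?thesis .
qed

lemma square_set_integral_le:
  fixes g :: "real \<Rightarrow> real"
  assumes [measurable]: "g \<in> borel_measurable borel" and "a \<le> b"
  shows "ennreal ((LINT s:{a..b}|lborel. g s)\<^sup>2)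
    \<le> ennreal (b - a) * (\<integral>\<^sup>+s\<in>{a..b}. ennreal ((g s)\<^sup>2) \<partial>lborel)"
  using square_integral_mult_le[of "indicator {a..b}" lborel g] assms(2)
  by (simp add: set_lebesgue_integral_def ennreal_indicator ennreal_mult' mult.commute)

text \<open>On an interval of finite length, 1 + g^2 is an integrable majorant of |g|.\<close>

lemma set_integrable_of_square:
  fixes g :: "real \<Rightarrow> real"
  assumes [measurable]: "g \<in> borel_measurable borel"
    and fin: "(\<integral>\<^sup>+s\<in>{a..b}. ennreal ((g s)\<^sup>2) \<partial>lborel) < \<infinity>"
  shows "set_integrable lborel {a..b} g"
proof -
  have "integrable lborel (\<lambda>s. indicator {a..b} s * (1 + (g s)\<^sup>2))"
  proof (rule integrableI_nonneg)
    have "(\<integral>\<^sup>+s. ennreal (indicator {a..b} s * (1 + (g s)\<^sup>2)) \<partial>lborel)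
        = (\<integral>\<^sup>+s. indicator {a..b} s + ennreal ((g s)\<^sup>2) * indicator {a..b} s \<partial>lborel)"
      by (intro nn_integral_cong) (auto simp: indicator_def)
    also have "\<dots> = emeasure lborel {a..b} + (\<integral>\<^sup>+s\<in>{a..b}. ennreal ((g s)\<^sup>2) \<partial>lborel)"
      by (subst nn_integral_add) auto
    also have "\<dots> < \<infinity>"
      using fin by (simp add: emeasure_lborel_Icc_eq)
    finally show "(\<integral>\<^sup>+s. ennreal (indicator {a..b} s * (1 + (g s)\<^sup>2)) \<partial>lborel) < \<infinity>" .
  qed auto
  then show ?thesis
    unfolding set_integrable_def
  proof (rule Bochner_Integration.integrable_bound)
    have "\<bar>y\<bar> \<le> 1 + y\<^sup>2" for y :: real
      using zero_le_power2[of "\<bar>y\<bar> - 1"] zero_le_power2[of y] unfolding power2_diff by (simp; linarith)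
    then show "AE s in lborel. norm (indicator {a..b} s *\<^sub>R g s) \<le> norm (indicator {a..b} s * (1 + (g s)\<^sup>2))"
      by (auto simp: indicator_def)
  qed auto
qed

lemma set_integral_diff_Icc:
  fixes g :: "real \<Rightarrow> real"
  assumes "set_integrable lborel {a..c} g" "a \<le> b" "b \<le> c"
  shows "(LINT s:{a..c}|lborel. g s) - (LINT s:{a..b}|lborel. g s) = (LINT s:{b..c}|lborel. g s)"
proof -
  have "(LINT s:{a..c}|lborel. g s) = (LINT s:{a..b} \<union> {b..c}|lborel. g s)"
    using assms(2,3) by (simp add: ivl_disj_un_two_touch)
  also have "\<dots> = (LINT s:{a..b}|lborel. g s) + (LINT s:{b..c}|lborel. g s)"
  proof (rule set_integral_Un_AE)
    have "AE s in lborel. s \<noteq> b" by (rule AE_lborel_singleton)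
    then show "AE s in lborel. \<not> (s \<in> {a..b} \<and> s \<in> {b..c})" by eventually_elim auto
  qed (use assms in \<open>auto intro: set_integrable_subset\<close>)
  finally show ?thesis by simp
qed

text \<open>One factor h comes from Cauchy--Schwarz on a window of length at most h. The other comes
  from exchanging the integrals: a time s lies only in the windows that end at some t between s and
  s + h.\<close>

lemma increment_square_le:
  fixes g :: "real \<Rightarrow> real"
  assumes [measurable]: "g \<in> borel_measurable borel" and h: "0 \<le> h"
    and int: "set_integrable lborel {0..T} g"
  shows "(\<integral>\<^sup>+t\<in>{0..T}. ennreal (((LINT s:{0..t}|lborel. g s) - (LINT s:{0..max (t - h) 0}|lborel. g s))\<^sup>2) \<partial>lborel)
    \<le> ennreal (h\<^sup>2) * (\<integral>\<^sup>+s\<in>{0..T}. ennreal ((g s)\<^sup>2) \<partial>lborel)" (is "?L \<le> _")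
proof -
  \<comment> \<open>Membership of s in the window ending at t is written as a condition on t, ready
    for the integration over t first.\<close>
  let ?K = "\<lambda>t s. ennreal h * (ennreal ((g s)\<^sup>2) * indicator {0..T} s * indicator {s..s + h} t)"
  have [measurable]: "Measurable.pred (borel \<Otimes>\<^sub>M borel) (\<lambda>p. fst p \<in> {snd p..snd p + h})"
    unfolding atLeastAtMost_iff by measurable
  have "?L \<le> (\<integral>\<^sup>+t. \<integral>\<^sup>+s. ?K t s \<partial>lborel \<partial>lborel)"
  proof (intro nn_integral_mono)
    fix t :: real
    let ?a = "max (t - h) 0"
    show "ennreal (((LINT s:{0..t}|lborel. g s) - (LINT s:{0..?a}|lborel. g s))\<^sup>2) * indicator {0..T} t
      \<le> (\<integral>\<^sup>+s. ?K t s \<partial>lborel)"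
    proof (cases "t \<in> {0..T}")
      case True
      have "(LINT s:{0..t}|lborel. g s) - (LINT s:{0..?a}|lborel. g s) = (LINT s:{?a..t}|lborel. g s)"
        using True h by (intro set_integral_diff_Icc set_integrable_subset[OF int]) auto
      then have "ennreal (((LINT s:{0..t}|lborel. g s) - (LINT s:{0..?a}|lborel. g s))\<^sup>2)
        \<le> ennreal (t - ?a) * (\<integral>\<^sup>+s\<in>{?a..t}. ennreal ((g s)\<^sup>2) \<partial>lborel)"
        using square_set_integral_le[of g ?a t] True h by simp
      also have "\<dots> \<le> ennreal h * (\<integral>\<^sup>+s. ennreal ((g s)\<^sup>2) * indicator {0..T} s * indicator {s..s + h} t \<partial>lborel)"
        using True h
        by (intro mult_mono[OF ennreal_leI nn_integral_mono]) (auto simp: indicator_def)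
      also have "\<dots> = (\<integral>\<^sup>+s. ?K t s \<partial>lborel)"
        unfolding atLeastAtMost_iff indicator_def by (intro nn_integral_cmult[symmetric]) measurable
      finally show ?thesis using True by simp
    qed auto
  qed
  also have "\<dots> = (\<integral>\<^sup>+s. \<integral>\<^sup>+t. ?K t s \<partial>lborel \<partial>lborel)"
    by (intro lborel_pair.Fubini'[symmetric]) measurable
  also have "\<dots> = (\<integral>\<^sup>+s. ennreal (h\<^sup>2) * (ennreal ((g s)\<^sup>2) * indicator {0..T} s) \<partial>lborel)"
    using h by (intro nn_integral_cong)
      (simp add: nn_integral_cmult mult.assoc ennreal_mult' power2_eq_square mult_ac)
  also have "\<dots> = ennreal (h\<^sup>2) * (\<integral>\<^sup>+s\<in>{0..T}. ennreal ((g s)\<^sup>2) \<partial>lborel)"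
    by (intro nn_integral_cmult) measurable
  finally show ?thesis .
qed

lemma delayed_nn_integral_le:
  fixes G :: "real \<Rightarrow> ennreal"
  assumes [measurable]: "G \<in> borel_measurable borel" and h: "0 \<le> h"
  shows "(\<integral>\<^sup>+t\<in>{0..T}. G (max (t - h) 0) \<partial>lborel) \<le> ennreal h * G 0 + (\<integral>\<^sup>+t\<in>{0..T}. G t \<partial>lborel)"
proof -
  have "(\<integral>\<^sup>+t\<in>{0..T}. G (max (t - h) 0) \<partial>lborel)
      \<le> (\<integral>\<^sup>+t. G 0 * indicator {0..h} t + G (t - h) * indicator {0..T} (t - h) \<partial>lborel)"
    using h by (intro nn_integral_mono) (auto simp: indicator_def max_def)
  also have "\<dots> = G 0 * ennreal h + (\<integral>\<^sup>+t. G (t - h) * indicator {0..T} (t - h) \<partial>lborel)"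
    using h by (simp add: nn_integral_add nn_integral_cmult)
  also have "(\<integral>\<^sup>+t. G (t - h) * indicator {0..T} (t - h) \<partial>lborel) = (\<integral>\<^sup>+t\<in>{0..T}. G t \<partial>lborel)"
    using nn_integral_real_affine[of "\<lambda>t. G t * indicator {0..T} t" 1 "-h"] by simp
  finally show ?thesis by (simp add: mult.commute)
qed

text \<open>The parameter is kept abstract because it is a time in pathwise arguments, a pair of
  time and sample point for the state of a control, and such a pair over \<open>F t\<close> for the
  feedback.\<close>

lemma measurable_running_integral:
  fixes Y :: "'b \<Rightarrow> real \<Rightarrow> real"
  assumes [measurable]: "a \<in> borel_measurable N" "(\<lambda>(p, s). Y p s) \<in> borel_measurable (N \<Otimes>\<^sub>M borel)"
  shows "(\<lambda>p. LINT s:{0..a p}|lborel. Y p s) \<in> borel_measurable N"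
proof -
  have [measurable]: "Measurable.pred (N \<Otimes>\<^sub>M borel) (\<lambda>q. snd q \<in> {0..a (fst q)})"
    unfolding atLeastAtMost_iff by measurable
  show ?thesis
    unfolding set_lebesgue_integral_def
    by (intro sigma_finite_measure.borel_measurable_lebesgue_integral[OF lborel.sigma_finite_measure_axioms])
      measurable
qed

lemma square_add3_le: "(a + b + c)\<^sup>2 \<le> 3 * (a\<^sup>2 + b\<^sup>2 + c\<^sup>2)" for a b c :: real
  using zero_le_power2[of "a - b"] zero_le_power2[of "b - c"] zero_le_power2[of "a - c"]
  by (simp add: power2_eq_square algebra_simps)

lemma path_modulus_le:
  fixes f g :: "real \<Rightarrow> real" and x :: real
  assumes [measurable]: "f \<in> borel_measurable borel" "g \<in> borel_measurable borel" and h: "0 < h"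
  defines "X \<equiv> \<lambda>t. x + (LINT s:{0..t}|lborel. g s)"
  shows "(\<integral>\<^sup>+t\<in>{0..T}. ennreal (\<bar>f t - f (max (t - h) 0)\<bar>\<^sup>2) \<partial>lborel)
    \<le> 6 * (\<integral>\<^sup>+t\<in>{0..T}. ennreal ((X t - f t)\<^sup>2) \<partial>lborel)
      + ennreal (3 * h\<^sup>2) * (\<integral>\<^sup>+t\<in>{0..T}. ennreal ((g t)\<^sup>2) \<partial>lborel)
      + ennreal (3 * h * (x - f 0)\<^sup>2)" (is "?L \<le> 6 * ?A + _ * ?U + _")
proof (cases "?U = \<infinity>")
  case True
  then show ?thesis using h by (simp add: ennreal_mult_top)
next
  case False
  \<comment> \<open>Finite energy makes the running integral additive over subintervals. With
    infinite energy the right-hand side is infinite, since h > 0.\<close>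
  then have int: "set_integrable lborel {0..T} g"
    by (intro set_integrable_of_square) (auto simp: top.not_eq_extremum)
  have [measurable]: "X \<in> borel_measurable borel"
    unfolding X_def by (intro borel_measurable_add measurable_running_integral) auto
  let ?d = "\<lambda>t. max (t - h) 0"
  have "?L \<le> (\<integral>\<^sup>+t. 3 * (ennreal ((X t - f t)\<^sup>2) * indicator {0..T} t
      + ennreal ((X t - X (?d t))\<^sup>2) * indicator {0..T} t
      + ennreal ((X (?d t) - f (?d t))\<^sup>2) * indicator {0..T} t) \<partial>lborel)"
  proof (intro nn_integral_mono)
    fix t
    have "(f t - f (?d t))\<^sup>2 = ((f t - X t) + (X t - X (?d t)) + (X (?d t) - f (?d t)))\<^sup>2"
      by simp
    also have "\<dots> \<le> 3 * ((f t - X t)\<^sup>2 + (X t - X (?d t))\<^sup>2 + (X (?d t) - f (?d t))\<^sup>2)"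
      by (rule square_add3_le)
    finally have "ennreal ((f t - f (?d t))\<^sup>2)
      \<le> ennreal (3 * ((X t - f t)\<^sup>2 + (X t - X (?d t))\<^sup>2 + (X (?d t) - f (?d t))\<^sup>2))"
      by (intro ennreal_leI) (simp add: power2_commute)
    then show "ennreal (\<bar>f t - f (?d t)\<bar>\<^sup>2) * indicator {0..T} t
      \<le> 3 * (ennreal ((X t - f t)\<^sup>2) * indicator {0..T} t
        + ennreal ((X t - X (?d t))\<^sup>2) * indicator {0..T} t
        + ennreal ((X (?d t) - f (?d t))\<^sup>2) * indicator {0..T} t)"
      by (auto simp: indicator_def ennreal_mult)
  qed
  also have "\<dots> = 3 * (?A + (\<integral>\<^sup>+t\<in>{0..T}. ennreal ((X t - X (?d t))\<^sup>2) \<partial>lborel)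
      + (\<integral>\<^sup>+t\<in>{0..T}. ennreal ((X (?d t) - f (?d t))\<^sup>2) \<partial>lborel))"
    by (simp add: nn_integral_cmult nn_integral_add)
  also have "\<dots> \<le> 3 * (?A + ennreal (h\<^sup>2) * ?U + (ennreal h * ennreal ((X 0 - f 0)\<^sup>2) + ?A))"
  proof (intro mult_left_mono add_mono order_refl)
    show "(\<integral>\<^sup>+t\<in>{0..T}. ennreal ((X t - X (?d t))\<^sup>2) \<partial>lborel) \<le> ennreal (h\<^sup>2) * ?U"
      using increment_square_le[OF assms(2) less_imp_le[OF h] int] by (simp add: X_def)
    show "(\<integral>\<^sup>+t\<in>{0..T}. ennreal ((X (?d t) - f (?d t))\<^sup>2) \<partial>lborel)
        \<le> ennreal h * ennreal ((X 0 - f 0)\<^sup>2) + ?A"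
      using h by (intro delayed_nn_integral_le) auto
  qed auto
  also have "X 0 = x"
    using AE_lborel_singleton[of 0]
    by (auto simp: X_def set_lebesgue_integral_def indicator_def intro!: integral_eq_zero_AE)
  finally have *: "?L \<le> 3 * (?A + ennreal (h\<^sup>2) * ?U + (ennreal h * ennreal ((x - f 0)\<^sup>2) + ?A))" .
  have eq: "ennreal (3 * h\<^sup>2) = 3 * ennreal (h\<^sup>2)"
    "ennreal (3 * h * (x - f 0)\<^sup>2) = 3 * (ennreal h * ennreal ((x - f 0)\<^sup>2))"
    using h by (simp_all add: ennreal_mult mult.assoc)
  have arrange: "3 * (a + b * u + (c + a)) = 6 * a + 3 * b * u + 3 * c" for a b c u :: ennreal
  proof -
    have "3 * (a + b * u + (c + a)) = (3 + 3) * a + 3 * b * u + 3 * c"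
      unfolding distrib_left distrib_right by (simp only: ac_simps)
    then show ?thesis by simp
  qed
  show ?thesis using *[unfolded arrange] unfolding eq .
qed

section \<open>Exponential smoothing of a path\<close>

lemma set_integrable_exp_mult:
  fixes f :: "real \<Rightarrow> real"
  assumes l: "0 < l" and int: "set_integrable lborel {a..t} f"
  shows "set_integrable lborel {a..t} (\<lambda>s. l * exp (l * s) * f s)"
  unfolding set_integrable_def
proof (rule Bochner_Integration.integrable_bound)
  show "integrable lborel (\<lambda>s. l * exp (l * t) * (indicator {a..t} s *\<^sub>R f s))"
    using int by (simp add: set_integrable_def)
  have [measurable]: "(\<lambda>s. indicator {a..t} s *\<^sub>R f s) \<in> borel_measurable borel"
    using int[unfolded set_integrable_def, THEN borel_measurable_integrable] by simp
  have "(\<lambda>s. l * exp (l * s) * (indicator {a..t} s *\<^sub>R f s)) \<in> borel_measurable borel"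
    by measurable
  then show "(\<lambda>s. indicator {a..t} s *\<^sub>R (l * exp (l * s) * f s)) \<in> borel_measurable lborel"
    by (simp add: mult_ac)
  show "AE s in lborel. norm (indicator {a..t} s *\<^sub>R (l * exp (l * s) * f s))
      \<le> norm (l * exp (l * t) * (indicator {a..t} s *\<^sub>R f s))"
    using l by (auto simp: abs_mult indicator_def intro!: mult_right_mono)
qed

text \<open>The solution of \<open>X' = l (f - X)\<close> with \<open>X 0 = x\<close>.\<close>

definition exp_smoothing :: "real \<Rightarrow> real \<Rightarrow> (real \<Rightarrow> real) \<Rightarrow> real \<Rightarrow> real"
  where "exp_smoothing l x f t = exp (- l * t) * (x + (LINT s:{0..t}|lborel. l * exp (l * s) * f s))"

lemma measurable_exp_smoothing:
  assumes [measurable]: "f \<in> borel_measurable borel"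
  shows "exp_smoothing l x f \<in> borel_measurable borel"
  unfolding exp_smoothing_def[abs_def]
  by (intro borel_measurable_times borel_measurable_add measurable_running_integral) measurable

text \<open>Since \<open>f\<close> is merely integrable, the differential equation is verified in
  integrated form, by Fubini: the double integral of l * exp (- l * (s - r)) * f r over 0 \<le> r
  \<le> s \<le> t is the integral of (1 - exp (- l * (t - r))) * f r over r.\<close>

lemma exp_smoothing_eq_integral:
  fixes f :: "real \<Rightarrow> real" and x :: real
  assumes [measurable]: "f \<in> borel_measurable borel" and l: "0 < l" and t: "0 \<le> t"
    and int: "set_integrable lborel {0..t} f"
  shows "x + (LINT s:{0..t}|lborel. l * (f s - exp_smoothing l x f s)) = exp_smoothing l x f t"
proof -
  define X where "X = exp_smoothing l x f"
  note X_def = this[unfolded exp_smoothing_def[abs_def]]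
  let ?k = "\<lambda>p::real \<times> real. indicator {0..snd p} (fst p) * indicator {0..t} (snd p) * exp (- l * snd p) * (l * exp (l * fst p) * f (fst p))"
  have [measurable]: "Measurable.pred (borel \<Otimes>\<^sub>M borel) (\<lambda>p::real\<times>real. fst p \<in> {0..snd p})"
    unfolding atLeastAtMost_iff by measurable
  define E where "E = l * exp (l * t)"
  have f_int: "integrable lborel (\<lambda>r. indicator {0..t} r * f r)"
    using int by (simp add: set_integrable_def)
  have k_int: "integrable (lborel \<Otimes>\<^sub>M lborel) ?k"
  proof (rule Bochner_Integration.integrable_bound)
    \<comment> \<open>On 0 \<le> r \<le> s \<le> t the exponential factors are at most 1 and
      \<open>exp (l * t)\<close>, so the kernel is dominated by a product of an integrable function
      of r and an indicator in s.\<close>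
    let ?B = "\<lambda>p::real \<times> real. E * (indicator {0..t} (fst p) * f (fst p)) * indicator {0..t} (snd p)"
    show "integrable (lborel \<Otimes>\<^sub>M lborel) ?B"
      using f_int integrable_abs[OF f_int] t
      by (intro lborel_pair.Fubini_integrable) (auto simp: abs_mult)
    show "AE p in lborel \<Otimes>\<^sub>M lborel. norm (?k p) \<le> norm (?B p)"
    proof (intro AE_I2)
      fix p :: "real \<times> real"
      show "norm (?k p) \<le> norm (?B p)"
      proof (cases "0 \<le> fst p \<and> fst p \<le> snd p \<and> 0 \<le> snd p \<and> snd p \<le> t")
        case True
        then have "exp (- l * snd p) * (l * exp (l * fst p)) \<le> 1 * (l * exp (l * t))"
          using l by (intro mult_mono) auto
        then show ?thesis
          using True l by (auto simp: abs_mult E_def mult.assoc[symmetric] intro!: mult_right_mono)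
      qed (auto simp: indicator_def)
    qed
  qed measurable
  have 1: "(\<integral>r. ?k (r, s) \<partial>lborel)
    = indicator {0..t} s * (exp (- l * s) * (LINT r:{0..s}|lborel. l * exp (l * r) * f r))" for s
  proof -
    have "(\<integral>r. ?k (r, s) \<partial>lborel)
      = (\<integral>r. indicator {0..t} s * exp (- l * s) * (indicator {0..s} r * (l * exp (l * r) * f r)) \<partial>lborel)"
      by (simp add: mult_ac)
    then show ?thesis by (simp add: set_lebesgue_integral_def)
  qed
  have exp_int: "(\<integral>s. exp (- l * s) * indicator {r..t} s \<partial>lborel) = (exp (- l * r) - exp (- l * t)) / l"
    if "r \<le> t" for r
    using l that by (subst integral_FTC_Icc_real[where F="\<lambda>s. - exp (- l * s) / l"])
      (auto intro!: derivative_eq_intros continuous_intros simp: field_simps)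
  have 2: "(\<integral>s. ?k (r, s) \<partial>lborel)
    = indicator {0..t} r * f r - exp (- l * t) / l * (indicator {0..t} r * (l * exp (l * r) * f r))" for r
  proof (cases "r \<in> {0..t}")
    case True
    have "(\<integral>s. ?k (r, s) \<partial>lborel) = (\<integral>s. l * exp (l * r) * f r * (exp (- l * s) * indicator {r..t} s) \<partial>lborel)"
      using True by (intro Bochner_Integration.integral_cong) (auto simp: indicator_def)
    also have "\<dots> = l * exp (l * r) * f r * ((exp (- l * r) - exp (- l * t)) / l)"
      using True by (simp only: integral_mult_right_zero exp_int atLeastAtMost_iff)
    also have "\<dots> = (exp (l * r) * exp (- l * r)) * f r - exp (- l * t) * exp (l * r) * f r"
      using l by (simp add: field_simps)
    finally show ?thesis using True l by (simp flip: exp_add)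
  next
    case False
    then have "?k (r, s) = 0" for s by (auto simp: indicator_def)
    then have "(\<integral>s. ?k (r, s) \<partial>lborel) = 0" by (simp only: integral_zero)
    then show ?thesis using False by simp
  qed
  have int_exp: "integrable lborel (\<lambda>s. indicator {0..t} s * (l * exp (l * s) * f s))"
    using set_integrable_exp_mult[OF l int] by (simp add: set_integrable_def)
  let ?I = "LINT s:{0..t}|lborel. l * exp (l * s) * f s"
  have I: "(\<integral>s. indicator {0..t} s * (l * exp (l * s) * f s) \<partial>lborel) = ?I"
    by (simp add: set_lebesgue_integral_def)
  have i1: "integrable lborel (\<lambda>s. x * (exp (- l * s) * indicator {0..t} s))"
  proof -
    have "continuous_on {0..t} (\<lambda>s. exp (- l * s))"
      by (intro continuous_intros)
    then show ?thesis
      using borel_integrable_atLeastAtMost'[of 0 t "\<lambda>s. exp (- l * s)"]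
      by (intro integrable_mult_right) (simp add: set_integrable_def mult.commute)
  qed
  have i2: "integrable lborel (\<lambda>s. indicator {0..t} s * (exp (- l * s) * (LINT r:{0..s}|lborel. l * exp (l * r) * f r)))"
    using lborel_pair.integrable_snd[of "\<lambda>r s. ?k (r, s)"] k_int unfolding 1 by (simp add: case_prod_beta')
  have X_split: "indicator {0..t} s * X s = x * (exp (- l * s) * indicator {0..t} s)
      + indicator {0..t} s * (exp (- l * s) * (LINT r:{0..s}|lborel. l * exp (l * r) * f r))" for s
    by (simp add: X_def algebra_simps)
  have X_int: "integrable lborel (\<lambda>s. indicator {0..t} s * X s)"
    unfolding X_split using i1 i2 by (rule Bochner_Integration.integrable_add)
  have "(\<integral>s. indicator {0..t} s * (exp (- l * s) * (LINT r:{0..s}|lborel. l * exp (l * r) * f r)) \<partial>lborel)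
      = (\<integral>s. \<integral>r. ?k (r, s) \<partial>lborel \<partial>lborel)"
    unfolding 1 ..
  also have "\<dots> = (\<integral>r. \<integral>s. ?k (r, s) \<partial>lborel \<partial>lborel)"
    using lborel_pair.Fubini_integral[of "\<lambda>r s. ?k (r, s)"] k_int by (simp add: case_prod_beta')
  also have "\<dots> = (\<integral>r. indicator {0..t} r * f r \<partial>lborel) - exp (- l * t) / l * ?I"
    unfolding 2 by (subst Bochner_Integration.integral_diff)
      (use f_int int_exp in \<open>auto simp: I simp del: times_divide_eq_left\<close>)
  finally have "(\<integral>s. indicator {0..t} s * X s \<partial>lborel)
      = x * ((1 - exp (- l * t)) / l) + ((\<integral>r. indicator {0..t} r * f r \<partial>lborel) - exp (- l * t) / l * ?I)"
    unfolding X_split using exp_int[OF t] by (subst Bochner_Integration.integral_add[OF i1 i2]) simp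
  moreover have "(LINT s:{0..t}|lborel. l * (f s - X s))
      = l * ((\<integral>s. indicator {0..t} s * f s \<partial>lborel) - (\<integral>s. indicator {0..t} s * X s \<partial>lborel))"
    unfolding Bochner_Integration.integral_diff[OF f_int X_int, symmetric] integral_mult_right_zero[symmetric]
    by (simp add: set_lebesgue_integral_def algebra_simps)
  \<comment> \<open>The integrals of \<open>f\<close> cancel, and what remains of the x-terms
    combines to \<open>exp (- l * t) * (x + ?I)\<close>.\<close>
  ultimately show ?thesis
    using l by (simp add: X_def exp_smoothing_def[abs_def] field_simps)
qed

lemma nn_integral_exponential_density:
  assumes "0 < l"
  shows "(\<integral>\<^sup>+h. ennreal (exponential_density l h) \<partial>lborel) = 1"
  using prob_space.emeasure_space_1[OF prob_space_exponential_density[OF assms]]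
  by (simp add: emeasure_density)

text \<open>The substitution s = t - h turns the smoothing kernel into the exponential density on
  [0, t]. The remaining mass \<open>exp (- l * t)\<close>, carried by h > t, is the weight that the
  smoothing gives to its initial value, and there the delayed value is \<open>f 0\<close>
  too.\<close>

lemma exp_smoothing_diff_eq:
  fixes f :: "real \<Rightarrow> real"
  assumes [measurable]: "f \<in> borel_measurable borel" and l: "0 < l" and t: "0 \<le> t"
    and int: "set_integrable lborel {0..t} f"
  shows "exp_smoothing l (f 0) f t - f t
    = (\<integral>h. exponential_density l h * (f (max (t - h) 0) - f t) \<partial>lborel)"
proof -
  let ?k = "exponential_density l" and ?x = "f 0"
  have "has_bochner_integral lborel ?k 1"
    using nn_integral_exponential_density[OF l] l
    by (intro has_bochner_integral_nn_integral) (auto intro: exponential_density_nonneg)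
  \<comment> \<open>The deviation of the delayed path from \<open>f 0\<close> is integrated first,
    because it vanishes for h > t and leaves only a bounded window to substitute. Total mass 1 then
    allows \<open>f 0\<close> to be exchanged for \<open>f t\<close> by adding this constant
    multiple of the density.\<close>
  note k = this[THEN has_bochner_integral_mult_right, of "?x - f t"]
  have e: "has_bochner_integral lborel (\<lambda>s. indicator {0..t} s *\<^sub>R (l * exp (l * s))) (exp (l * t) - exp (l * 0))"
    using t by (intro has_bochner_integral_FTC_Icc)
     (auto simp: has_real_derivative_iff_has_vector_derivative[symmetric] intro!: derivative_eq_intros continuous_intros)
  have "has_bochner_integral lborel (\<lambda>s. indicator {0..t} s *\<^sub>R (l * exp (l * s) * f s))
      (LINT s:{0..t}|lborel. l * exp (l * s) * f s)" (is "has_bochner_integral _ _ ?I")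
    using set_integrable_exp_mult[OF l int]
    unfolding set_integrable_def set_lebesgue_integral_def by (rule has_bochner_integral_integrable)
  from has_bochner_integral_diff[OF this has_bochner_integral_mult_right[OF e, of ?x]]
  have "has_bochner_integral lborel (\<lambda>s. exp (- l * t) * (indicator {0..t} s *\<^sub>R (l * exp (l * s) * f s)
      - ?x * (indicator {0..t} s *\<^sub>R (l * exp (l * s))))) (exp (- l * t) * (?I - ?x * (exp (l * t) - exp (l * 0))))"
    by (intro has_bochner_integral_mult_right) auto
  then have "has_bochner_integral lborel (\<lambda>h. exp (- l * t) * (indicator {0..t} (t + - 1 * h) *\<^sub>R (l * exp (l * (t + - 1 * h)) * f (t + - 1 * h))
      - ?x * (indicator {0..t} (t + - 1 * h) *\<^sub>R (l * exp (l * (t + - 1 * h))))))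
      (exp (- l * t) * (?I - ?x * (exp (l * t) - exp (l * 0))))"
    by (subst (asm) lborel_has_bochner_integral_real_affine_iff[where c="-1" and t=t]) auto
  also have "(\<lambda>h. exp (- l * t) * (indicator {0..t} (t + - 1 * h) *\<^sub>R (l * exp (l * (t + - 1 * h)) * f (t + - 1 * h))
      - ?x * (indicator {0..t} (t + - 1 * h) *\<^sub>R (l * exp (l * (t + - 1 * h))))))
    = (\<lambda>h. ?k h * (f (max (t - h) 0) - ?x))"
  proof
    fix h
    have "exp (- l * t) * exp (l * (t - h)) = exp (- h * l)"
      by (simp add: algebra_simps flip: exp_add)
    then have shift: "exp (- l * t) * (l * exp (l * (t - h)) * y - z * (l * exp (l * (t - h)))) = l * exp (- h * l) * (y - z)" for y z
      by (metis mult.assoc mult.commute right_diff_distrib)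
    consider "h < 0" | "0 \<le> h" "h \<le> t" | "t < h" by linarith
    then show "exp (- l * t) * (indicator {0..t} (t + - 1 * h) *\<^sub>R (l * exp (l * (t + - 1 * h)) * f (t + - 1 * h))
      - ?x * (indicator {0..t} (t + - 1 * h) *\<^sub>R (l * exp (l * (t + - 1 * h)))))
    = ?k h * (f (max (t - h) 0) - ?x)"
    proof cases
      case 2
      then show ?thesis
        using shift[of "f (t - h)" ?x] by (simp add: exponential_density_def)
    qed (auto simp: exponential_density_def)
  qed
  finally have "has_bochner_integral lborel (\<lambda>h. ?k h * (f (max (t - h) 0) - ?x))
     (exp (- l * t) * (?I - ?x * (exp (l * t) - exp (l * 0))))" .
  from has_bochner_integral_add[OF this k]
  have "has_bochner_integral lborel (\<lambda>h. ?k h * (f (max (t - h) 0) - f t))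
    (exp (- l * t) * (?I - ?x * (exp (l * t) - exp (l * 0))) + (?x - f t) * 1)"
    by (rule has_bochner_integral_cong[THEN iffD1, rotated -1]) (auto simp: algebra_simps)
  from has_bochner_integral_integral_eq[OF this] show ?thesis
    by (simp add: exp_smoothing_def algebra_simps flip: exp_add)
qed

lemma exp_smoothing_error_le:
  fixes f :: "real \<Rightarrow> real"
  assumes [measurable]: "f \<in> borel_measurable borel" and l: "0 < l"
    and int: "set_integrable lborel {0..T} f"
  shows "(\<integral>\<^sup>+t\<in>{0..T}. ennreal ((exp_smoothing l (f 0) f t - f t)\<^sup>2) \<partial>lborel)
    \<le> (\<integral>\<^sup>+h\<in>{0<..}. ennreal (l * exp (- h * l)) *
        (\<integral>\<^sup>+t\<in>{0..T}. ennreal (\<bar>f t - f (max (t - h) 0)\<bar>\<^sup>2) \<partial>lborel) \<partial>lborel)" (is "?L \<le> ?R")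
proof -
  let ?K = "\<lambda>t h. ennreal (l * exp (- h * l)) * indicator {0<..} h *
    (ennreal (\<bar>f t - f (max (t - h) 0)\<bar>\<^sup>2) * indicator {0..T} t)"
  have "?L \<le> (\<integral>\<^sup>+t. \<integral>\<^sup>+h. ?K t h \<partial>lborel \<partial>lborel)"
  proof (intro nn_integral_mono)
    fix t
    show "ennreal ((exp_smoothing l (f 0) f t - f t)\<^sup>2) * indicator {0..T} t \<le> (\<integral>\<^sup>+h. ?K t h \<partial>lborel)"
    proof (cases "t \<in> {0..T}")
      case True
      have "ennreal ((exp_smoothing l (f 0) f t - f t)\<^sup>2)
          = ennreal ((\<integral>h. exponential_density l h * (f (max (t - h) 0) - f t) \<partial>lborel)\<^sup>2)"
        using True l by (subst exp_smoothing_diff_eq) (auto intro: set_integrable_subset[OF int])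
      also have "\<dots> \<le> (\<integral>\<^sup>+h. ennreal (exponential_density l h) \<partial>lborel) *
          (\<integral>\<^sup>+h. ennreal (exponential_density l h * (f (max (t - h) 0) - f t)\<^sup>2) \<partial>lborel)"
        by (rule square_integral_mult_le) (auto intro: exponential_density_nonneg[OF l])
      \<comment> \<open>The density is positive at h = 0 as well, but the delayed difference
        vanishes there, so the open half-line loses nothing.\<close>
      also have "\<dots> = (\<integral>\<^sup>+h. ?K t h \<partial>lborel)"
        using True l unfolding nn_integral_exponential_density[OF l] mult_1
        by (intro nn_integral_cong) (auto simp: indicator_def exponential_density_def ennreal_mult power2_commute)
      finally show ?thesis using True by simp
    qed auto
  qed
  also have "\<dots> = (\<integral>\<^sup>+h. \<integral>\<^sup>+t. ?K t h \<partial>lborel \<partial>lborel)"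
    by (intro lborel_pair.Fubini'[symmetric]) measurable
  also have "\<dots> = ?R"
    by (intro nn_integral_cong, subst nn_integral_cmult) (auto simp: mult_ac)
  finally show ?thesis .
qed

text \<open>Euler's integral after the substitution s = l * h. For l = 1 / sqrt \<kappa>, the
  prefactor 1 / sqrt \<kappa> of the upper bound cancels one of the \<alpha> + 1 powers of sqrt
  \<kappa>.\<close>

lemma nn_integral_exp_powr:
  assumes l: "0 < l" and \<alpha>: "0 < \<alpha>"
  shows "(\<integral>\<^sup>+h\<in>{0<..}. ennreal (exp (- h * l)) * ennreal (h powr \<alpha>) \<partial>lborel)
    = ennreal (Gamma (\<alpha> + 1) * (1 / l) powr (\<alpha> + 1))"
proof -
  have "ennreal (Gamma (\<alpha> + 1)) = (\<integral>\<^sup>+s. ennreal (s powr \<alpha> / exp s) * indicator {0..} s \<partial>lborel)"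
    using Gamma_integral_real[of "\<alpha> + 1"] \<alpha>
    by (subst nn_integral_has_integral_lebesgue'[where \<Omega>="{0..}" and I="Gamma (\<alpha> + 1)"]) auto
  also have "\<dots> = ennreal l * (\<integral>\<^sup>+h. ennreal ((l * h) powr \<alpha> / exp (l * h)) * indicator {0..} (l * h) \<partial>lborel)"
    using nn_integral_real_affine[of "\<lambda>s. ennreal (s powr \<alpha> / exp s) * indicator {0..} s" l 0] l by simp
  also have "(\<integral>\<^sup>+h. ennreal ((l * h) powr \<alpha> / exp (l * h)) * indicator {0..} (l * h) \<partial>lborel)
     = (\<integral>\<^sup>+h. ennreal (l powr \<alpha>) * (ennreal (exp (- h * l)) * ennreal (h powr \<alpha>) * indicator {0<..} h) \<partial>lborel)"
    using l \<alpha> by (intro nn_integral_cong)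
      (auto simp: indicator_def zero_le_mult_iff powr_mult exp_minus field_simps simp flip: ennreal_mult)
  also have "\<dots> = ennreal (l powr \<alpha>) * (\<integral>\<^sup>+h\<in>{0<..}. ennreal (exp (- h * l)) * ennreal (h powr \<alpha>) \<partial>lborel)"
    by (intro nn_integral_cmult) measurable
  finally have "ennreal (Gamma (\<alpha> + 1)) = ennreal (l powr (\<alpha> + 1)) *
      (\<integral>\<^sup>+h\<in>{0<..}. ennreal (exp (- h * l)) * ennreal (h powr \<alpha>) \<partial>lborel)"
    using l by (simp add: powr_add ennreal_mult mult_ac)
  then have "ennreal ((1 / l) powr (\<alpha> + 1)) * ennreal (Gamma (\<alpha> + 1))
    = (ennreal ((1 / l) powr (\<alpha> + 1)) * ennreal (l powr (\<alpha> + 1))) *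
      (\<integral>\<^sup>+h\<in>{0<..}. ennreal (exp (- h * l)) * ennreal (h powr \<alpha>) \<partial>lborel)"
    by (simp add: mult.assoc)
  also have "ennreal ((1 / l) powr (\<alpha> + 1)) * ennreal (l powr (\<alpha> + 1)) = 1"
    using l by (simp add: powr_divide flip: ennreal_mult)
  finally show ?thesis
    using \<alpha> by (simp add: ennreal_mult'' mult.commute)
qed

section \<open>Processes with clamped time\<close>

text \<open>
  Clamping the time to \<open>[0, T]\<close> makes a progressive process jointly measurable on the whole line,
  and changes neither costs nor moduli.
\<close>

definition stopped :: "real \<Rightarrow> (real \<Rightarrow> 'a \<Rightarrow> real) \<Rightarrow> real \<Rightarrow> 'a \<Rightarrow> real"
  where "stopped T Y s w = Y (max 0 (min T s)) w"

lemma stopped_eq: "s \<in> {0..T} \<Longrightarrow> stopped T Y s w = Y s w"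
  by (simp add: stopped_def)

text \<open>Clamping maps the line measurably into [0, t]. The case t = T yields joint
  measurability; clamping at the same t as the sigma-algebra \<open>F t\<close> preserves the
  information structure, as required for the feedback.\<close>

lemma progressively_measurable_stopped:
  assumes "progressively_measurable F T Y" "t \<in> {0..T}"
  shows "(\<lambda>(s, w). stopped t Y s w) \<in> borel_measurable (borel \<Otimes>\<^sub>M F t)"
proof -
  have [measurable]: "(\<lambda>s. max 0 (min t s)) \<in> borel \<rightarrow>\<^sub>M restrict_space borel {0..t}"
    using assms(2) by (intro measurable_restrict_space2) auto
  have [measurable]: "(\<lambda>(s, w). Y s w) \<in> borel_measurable (restrict_space borel {0..t} \<Otimes>\<^sub>M F t)"
    using assms by (auto simp: progressively_measurable_def)
  show ?thesis unfolding stopped_def by measurable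
qed

lemma L2_modulus_stopped:
  assumes "0 \<le> h" shows "L2_modulus M T (stopped T \<xi>) h = L2_modulus M T \<xi> h"
  unfolding L2_modulus_def using assms
  by (intro nn_integral_cong) (auto simp: stopped_def indicator_def max_def)

lemma controlled_state_stopped:
  assumes "t \<in> {0..T}" shows "controlled_state x (stopped T u) t w = controlled_state x u t w"
  unfolding controlled_state_def using assms
  by (auto simp: stopped_eq intro!: set_lebesgue_integral_cong)

lemma exp_smoothing_stopped:
  assumes "t \<in> {0..T}"
  shows "exp_smoothing l x (\<lambda>s. stopped T Y s w) t = exp_smoothing l x (\<lambda>s. Y s w) t"
  unfolding exp_smoothing_def using assms
  by (intro arg_cong2[where f="(*)"] arg_cong2[where f="(+)"] set_lebesgue_integral_cong refl)
    (auto simp: stopped_eq)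

lemma tracking_cost_stopped:
  "tracking_cost M T (stopped T \<xi>) x \<kappa> (stopped T u) = tracking_cost M T \<xi> x \<kappa> u"
proof -
  have "(\<integral>\<^sup>+t\<in>{0..T}. ennreal ((controlled_state x (stopped T u) t w - stopped T \<xi> t w)\<^sup>2) \<partial>lborel)
      = (\<integral>\<^sup>+t\<in>{0..T}. ennreal ((controlled_state x u t w - \<xi> t w)\<^sup>2) \<partial>lborel)"
    "(\<integral>\<^sup>+t\<in>{0..T}. ennreal ((stopped T u t w)\<^sup>2) \<partial>lborel) = (\<integral>\<^sup>+t\<in>{0..T}. ennreal ((u t w)\<^sup>2) \<partial>lborel)" for w
    by (auto simp: stopped_eq controlled_state_stopped indicator_def intro!: nn_integral_cong)
  then show ?thesis by (simp add: tracking_cost_def)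
qed

lemma measurable_subalgebra_pair:
  assumes "subalgebra M G" "f \<in> borel_measurable (N \<Otimes>\<^sub>M G)"
  shows "f \<in> borel_measurable (N \<Otimes>\<^sub>M M)"
proof -
  have "(\<lambda>x. x) \<in> M \<rightarrow>\<^sub>M G"
    using assms(1) by (auto simp: measurable_def subalgebra_def intro: sets.Int_space_eq2 dest!: subsetD)
  then have "(\<lambda>p. (fst p, snd p)) \<in> N \<Otimes>\<^sub>M M \<rightarrow>\<^sub>M N \<Otimes>\<^sub>M G"
    by (intro measurable_Pair) (auto intro: measurable_compose[OF measurable_snd])
  from measurable_compose[OF this assms(2)] show ?thesis by simp
qed

section \<open>Cost of an arbitrary control and cost of the feedback\<close>

context usual_filtered_prob_space
begin

lemma measurable_stopped:
  assumes "progressively_measurable F T Y"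
  shows "(\<lambda>(s, w). stopped T Y s w) \<in> borel_measurable (borel \<Otimes>\<^sub>M M)"
  using T_pos progressively_measurable_stopped[OF assms, of T]
  by (intro measurable_subalgebra_pair[OF subalgebra_F[of T]]) auto

text \<open>The expectation of \<open>path_modulus_le\<close>, with \<kappa> = h^2 / 2 chosen so
  that the factors 6, 3 * h^2 and 3 * h are 12 times 1/2, \<kappa>/2 and h/4.\<close>

lemma L2_modulus_le_tracking_cost:
  assumes \<xi>: "progressively_measurable F T \<xi>" and u: "progressively_measurable F T u" and h: "0 < h"
  shows "L2_modulus M T \<xi> h
    \<le> 12 * (tracking_cost M T \<xi> x (h\<^sup>2 / 2) u + ennreal (h / 4) * (\<integral>\<^sup>+w. ennreal ((x - \<xi> 0 w)\<^sup>2) \<partial>M))"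
proof -
  define Z where "Z = stopped T \<xi>"
  define V where "V = stopped T u"
  have [measurable]: "(\<lambda>(s, w). Z s w) \<in> borel_measurable (borel \<Otimes>\<^sub>M M)"
     "(\<lambda>(s, w). V s w) \<in> borel_measurable (borel \<Otimes>\<^sub>M M)"
    unfolding Z_def V_def using \<xi> u by (auto intro: measurable_stopped)
  have [measurable]: "(\<lambda>(t, w). controlled_state x V t w) \<in> borel_measurable (borel \<Otimes>\<^sub>M M)"
    unfolding controlled_state_def case_prod_beta
    by (intro borel_measurable_add measurable_running_integral) measurable
  let ?A = "\<lambda>w. \<integral>\<^sup>+t\<in>{0..T}. ennreal ((controlled_state x V t w - Z t w)\<^sup>2) \<partial>lborel"
  let ?U = "\<lambda>w. \<integral>\<^sup>+t\<in>{0..T}. ennreal ((V t w)\<^sup>2) \<partial>lborel"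
  let ?c = "\<lambda>w. ennreal (1 / 2) * ?A w + ennreal (h\<^sup>2 / 2 / 2) * ?U w"
  have [measurable]: "?A \<in> borel_measurable M" "?U \<in> borel_measurable M"
    by measurable
  have "L2_modulus M T \<xi> h = L2_modulus M T Z h"
    using h by (simp add: Z_def L2_modulus_stopped)
  also have "\<dots> \<le> (\<integral>\<^sup>+w. 12 * (?c w + ennreal (h / 4) * ennreal ((x - Z 0 w)\<^sup>2)) \<partial>M)"
    unfolding L2_modulus_def
  proof (intro nn_integral_mono)
    fix w assume [measurable]: "w \<in> space M"
    have scale: "12 * ennreal a = ennreal (12 * a)" if "0 \<le> a" for a
      using that by (simp add: ennreal_mult)
    have "12 * ennreal (1 / 2) = ennreal 6" "12 * ennreal (h\<^sup>2 / 2 / 2) = ennreal (3 * h\<^sup>2)"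
      "12 * (ennreal (h / 4) * ennreal ((x - Z 0 w)\<^sup>2)) = ennreal (3 * h * (x - Z 0 w)\<^sup>2)"
      using h scale[of "1 / 2"] scale[of "h\<^sup>2 / 2 / 2"] scale[of "h / 4 * (x - Z 0 w)\<^sup>2"]
        ennreal_mult[of "h / 4" "(x - Z 0 w)\<^sup>2"]
      by (simp_all add: mult.assoc)
    then have "12 * (?c w + ennreal (h / 4) * ennreal ((x - Z 0 w)\<^sup>2))
      = 6 * ?A w + ennreal (3 * h\<^sup>2) * ?U w + ennreal (3 * h * (x - Z 0 w)\<^sup>2)"
      by (simp only: distrib_left mult.assoc[symmetric] ennreal_numeral)
    then show "(\<integral>\<^sup>+t\<in>{0..T}. ennreal (\<bar>Z t w - Z (max (t - h) 0) w\<bar>\<^sup>2) \<partial>lborel)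
      \<le> 12 * (?c w + ennreal (h / 4) * ennreal ((x - Z 0 w)\<^sup>2))"
      using path_modulus_le[of "\<lambda>t. Z t w" "\<lambda>t. V t w" h T x] h
      unfolding controlled_state_def by (simp only:) measurable
  qed
  also have "\<dots> = 12 * ((\<integral>\<^sup>+w. ?c w \<partial>M) + ennreal (h / 4) * (\<integral>\<^sup>+w. ennreal ((x - Z 0 w)\<^sup>2) \<partial>M))"
    by (subst nn_integral_cmult, measurable, subst nn_integral_add) (auto simp: nn_integral_cmult)
  also have "(\<integral>\<^sup>+w. ?c w \<partial>M) = tracking_cost M T Z x (h\<^sup>2 / 2) V"
    unfolding tracking_cost_def ..
  also have "\<dots> = tracking_cost M T \<xi> x (h\<^sup>2 / 2) u"
    unfolding Z_def V_def by (rule tracking_cost_stopped)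
  finally show ?thesis using T_pos by (simp add: Z_def stopped_eq)
qed

text \<open>Up to time t the feedback reads the target only on [0, t], so the target can be replaced
  by its version clamped at t, which is jointly measurable over \<open>F t\<close>.\<close>

lemma progressively_measurable_feedback:
  assumes Y: "progressively_measurable F T \<xi>"
  shows "progressively_measurable F T (\<lambda>t w. l * (\<xi> t w - exp_smoothing l x (\<lambda>s. \<xi> s w) t))"
  unfolding progressively_measurable_def
proof
  fix t assume t: "t \<in> {0..T}"
  note [measurable] = progressively_measurable_stopped[OF Y t]
  let ?N = "restrict_space borel {0..t} \<Otimes>\<^sub>M F t"
  have [measurable]: "fst \<in> borel_measurable ?N"
    using measurable_restrict_space1[OF measurable_ident] by (intro measurable_compose[OF measurable_fst]) (auto simp: id_def)
  have "(\<lambda>p. l * (stopped t \<xi> (fst p) (snd p) - exp_smoothing l x (\<lambda>s. stopped t \<xi> s (snd p)) (fst p))) \<in> borel_measurable ?N"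
    unfolding exp_smoothing_def
    by (intro borel_measurable_times borel_measurable_diff borel_measurable_add measurable_running_integral) measurable
  also have "?this \<longleftrightarrow> (\<lambda>(s, w). l * (\<xi> s w - exp_smoothing l x (\<lambda>s. \<xi> s w) s)) \<in> borel_measurable ?N"
    by (intro measurable_cong) (auto simp: space_pair_measure space_restrict_space stopped_eq exp_smoothing_stopped)
  finally show "(\<lambda>(s, w). l * (\<xi> s w - exp_smoothing l x (\<lambda>s. \<xi> s w) s)) \<in> borel_measurable ?N" .
qed

lemma tracking_value_le:
  assumes \<xi>: "progressively_measurable F T \<xi>" and start: "AE w in M. x = \<xi> 0 w"
    and \<xi>_L2: "(\<integral>\<^sup>+w. (\<integral>\<^sup>+t\<in>{0..T}. ennreal ((\<xi> t w)\<^sup>2) \<partial>lborel) \<partial>M) < \<infinity>"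
    and l: "0 < l"
  shows "tracking_value M F T \<xi> x (1 / l\<^sup>2)
    \<le> ennreal l * (\<integral>\<^sup>+h\<in>{0<..}. ennreal (exp (- h * l)) * L2_modulus M T \<xi> h \<partial>lborel)" (is "_ \<le> ?R")
proof (cases "?R = \<infinity>")
  case False
  define Z where "Z = stopped T \<xi>"
  define u where "u = (\<lambda>t w. l * (\<xi> t w - exp_smoothing l x (\<lambda>s. \<xi> s w) t))"
  have Z[measurable]: "(\<lambda>(s, w). Z s w) \<in> borel_measurable (borel \<Otimes>\<^sub>M M)"
    unfolding Z_def using \<xi> by (rule measurable_stopped)
  let ?k = "\<lambda>h. ennreal (l * exp (- h * l)) * indicator {0<..} h"
  let ?D = "\<lambda>h w. \<integral>\<^sup>+t\<in>{0..T}. ennreal (\<bar>Z t w - Z (max (t - h) 0) w\<bar>\<^sup>2) \<partial>lborel"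
  \<comment> \<open>The pathwise majorant of the cost supplied by
    \<open>exp_smoothing_error_le\<close>; by Tonelli its expectation is the claimed bound.\<close>
  define B where "B = (\<lambda>w. \<integral>\<^sup>+h. ?k h * ?D h w \<partial>lborel)"
  have [measurable]: "(\<lambda>(h, w). ?D h w) \<in> borel_measurable (borel \<Otimes>\<^sub>M M)" by measurable
  have [measurable]: "B \<in> borel_measurable M" unfolding B_def by measurable
  have B: "(\<integral>\<^sup>+w. B w \<partial>M) = ?R"
  proof -
    interpret pair_sigma_finite lborel M ..
    have "(\<integral>\<^sup>+w. B w \<partial>M) = (\<integral>\<^sup>+h. (\<integral>\<^sup>+w. ?k h * ?D h w \<partial>M) \<partial>lborel)"
      unfolding B_def by (rule Fubini') measurable
    also have "\<dots> = (\<integral>\<^sup>+h. ennreal l * (ennreal (exp (- h * l)) * L2_modulus M T \<xi> h * indicator {0<..} h) \<partial>lborel)"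
    proof (intro nn_integral_cong)
      fix h :: real
      have "(\<integral>\<^sup>+w. ?k h * ?D h w \<partial>M) = ?k h * L2_modulus M T Z h"
        unfolding L2_modulus_def by (intro nn_integral_cmult) measurable
      also have "\<dots> = ?k h * L2_modulus M T \<xi> h"
        by (auto simp: Z_def L2_modulus_stopped indicator_def)
      finally show "(\<integral>\<^sup>+w. ?k h * ?D h w \<partial>M)
          = ennreal l * (ennreal (exp (- h * l)) * L2_modulus M T \<xi> h * indicator {0<..} h)"
        using l by (simp add: ennreal_mult mult_ac)
    qed
    also have "\<dots> = ?R"
    proof (intro nn_integral_cmult)
      \<comment> \<open>Measurability in h is inherited from the jointly measurable
        \<open>Z\<close>, whose modulus agrees with that of \<xi> for h > 0.\<close>
      have "(\<lambda>h. ennreal (exp (- h * l)) * L2_modulus M T Z h * indicator {0<..} h) \<in> borel_measurable lborel"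
        unfolding L2_modulus_def by measurable
      also have "(\<lambda>h. ennreal (exp (- h * l)) * L2_modulus M T Z h * indicator {0<..} h)
          = (\<lambda>h. ennreal (exp (- h * l)) * L2_modulus M T \<xi> h * indicator {0<..} h)"
        by (auto simp: Z_def L2_modulus_stopped indicator_def)
      finally show "(\<lambda>h. ennreal (exp (- h * l)) * L2_modulus M T \<xi> h * indicator {0<..} h) \<in> borel_measurable lborel" .
    qed
    finally show ?thesis .
  qed
  have "(\<integral>\<^sup>+w. (\<integral>\<^sup>+t\<in>{0..T}. ennreal ((Z t w)\<^sup>2) \<partial>lborel) \<partial>M) < \<infinity>"
  proof -
    have "(\<integral>\<^sup>+t\<in>{0..T}. ennreal ((Z t w)\<^sup>2) \<partial>lborel) = (\<integral>\<^sup>+t\<in>{0..T}. ennreal ((\<xi> t w)\<^sup>2) \<partial>lborel)" for w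
      by (auto simp: Z_def stopped_eq indicator_def intro!: nn_integral_cong)
    then show ?thesis using \<xi>_L2 by simp
  qed
  then have "AE w in M. (\<integral>\<^sup>+t\<in>{0..T}. ennreal ((Z t w)\<^sup>2) \<partial>lborel) \<noteq> \<infinity>"
    by (intro nn_integral_PInf_AE) (auto simp: less_top)
  \<comment> \<open>Almost every path is square-integrable and starts at x. On such a path the state
    of the feedback is the smoothing itself, so tracking error and control differ only by the factor
    -1/l.\<close>
  then have path: "AE w in M. (\<forall>t\<in>{0..T}. controlled_state x u t w - \<xi> t w = - (u t w / l))
      \<and> (\<integral>\<^sup>+t\<in>{0..T}. ennreal ((u t w / l)\<^sup>2) \<partial>lborel) \<le> B w"
    using start AE_space
  proof eventually_elim
    case (elim w)
    note w[measurable] = elim(3)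
    have Zw[measurable]: "(\<lambda>t. Z t w) \<in> borel_measurable borel" by measurable
    have int: "set_integrable lborel {0..T} (\<lambda>t. Z t w)"
      using elim(1) by (intro set_integrable_of_square) (auto simp: less_top)
    have u: "u t w = l * (Z t w - exp_smoothing l x (\<lambda>s. Z s w) t)" if "t \<in> {0..T}" for t
      using that by (simp add: u_def Z_def stopped_eq exp_smoothing_stopped)
    have x: "Z 0 w = x"
      using elim(2) T_pos by (simp add: Z_def stopped_eq)
    have "controlled_state x u t w - \<xi> t w = - (u t w / l)" if t: "t \<in> {0..T}" for t
    proof -
      have "controlled_state x u t w = x + (LINT s:{0..t}|lborel. l * (Z s w - exp_smoothing l x (\<lambda>s. Z s w) s))"
        unfolding controlled_state_def using t
        by (intro arg_cong2[where f="(+)"] set_lebesgue_integral_cong refl) (auto intro: u)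
      also have "\<dots> = exp_smoothing l x (\<lambda>s. Z s w) t"
        using t l by (intro exp_smoothing_eq_integral set_integrable_subset[OF int]) auto
      finally show ?thesis using l u[OF t] t by (simp add: Z_def stopped_eq)
    qed
    moreover have "(\<integral>\<^sup>+t\<in>{0..T}. ennreal ((u t w / l)\<^sup>2) \<partial>lborel) \<le> B w"
    proof -
      have "(\<integral>\<^sup>+t\<in>{0..T}. ennreal ((u t w / l)\<^sup>2) \<partial>lborel)
          = (\<integral>\<^sup>+t\<in>{0..T}. ennreal ((exp_smoothing l (Z 0 w) (\<lambda>s. Z s w) t - Z t w)\<^sup>2) \<partial>lborel)"
        using l by (intro nn_integral_cong) (auto simp: u x indicator_def power2_commute)
      also have "\<dots> \<le> B w"
        using exp_smoothing_error_le[OF Zw l int] by (simp add: B_def mult_ac)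
      finally show ?thesis .
    qed
    ultimately show ?case by blast
  qed
  have u_sq: "(\<integral>\<^sup>+t\<in>{0..T}. ennreal ((u t w)\<^sup>2) \<partial>lborel)
      = ennreal (l\<^sup>2) * (\<integral>\<^sup>+t\<in>{0..T}. ennreal ((u t w / l)\<^sup>2) \<partial>lborel)" if [measurable]: "w \<in> space M" for w
  proof -
    \<comment> \<open>Measurability of the control in time is again read off from \<open>Z\<close>;
      the indicator removes the times at which they may differ.\<close>
    have "(\<lambda>t. ennreal ((u t w / l)\<^sup>2) * indicator {0..T} t) \<in> borel_measurable lborel"
    proof -
      have "(\<lambda>t. ennreal ((Z t w - exp_smoothing l x (\<lambda>s. Z s w) t)\<^sup>2) * indicator {0..T} t) \<in> borel_measurable lborel"
        using measurable_exp_smoothing[of "\<lambda>s. Z s w" l x, measurable] by measurable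
      also have "(\<lambda>t. ennreal ((Z t w - exp_smoothing l x (\<lambda>s. Z s w) t)\<^sup>2) * indicator {0..T} t)
        = (\<lambda>t. ennreal ((u t w / l)\<^sup>2) * indicator {0..T} t)"
        using l by (auto simp: fun_eq_iff u_def Z_def stopped_eq exp_smoothing_stopped indicator_def)
      finally show ?thesis .
    qed
    from nn_integral_cmult[OF this, of "ennreal (l\<^sup>2)", symmetric] show ?thesis
      using l by (simp add: power_divide mult.assoc[symmetric] flip: ennreal_mult)
  qed
  have "u \<in> controls M F T"
    unfolding controls_def
  proof (intro CollectI conjI)
    show "progressively_measurable F T u"
      unfolding u_def by (rule progressively_measurable_feedback[OF \<xi>])
    have "(\<integral>\<^sup>+w. (\<integral>\<^sup>+t\<in>{0..T}. ennreal ((u t w)\<^sup>2) \<partial>lborel) \<partial>M) \<le> (\<integral>\<^sup>+w. ennreal (l\<^sup>2) * B w \<partial>M)"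
      using path AE_space by (intro nn_integral_mono_AE, eventually_elim) (auto simp: u_sq intro!: mult_left_mono)
    also have "\<dots> = ennreal (l\<^sup>2) * ?R"
      by (simp add: nn_integral_cmult B)
    also have "\<dots> < \<infinity>"
      using False by (simp add: ennreal_mult_less_top less_top)
    finally show "(\<integral>\<^sup>+w. (\<integral>\<^sup>+t\<in>{0..T}. ennreal ((u t w)\<^sup>2) \<partial>lborel) \<partial>M) < \<infinity>" .
  qed
  have cost: "AE w in M. ennreal (1 / 2) * (\<integral>\<^sup>+t\<in>{0..T}. ennreal ((controlled_state x u t w - \<xi> t w)\<^sup>2) \<partial>lborel)
      + ennreal (1 / l\<^sup>2 / 2) * (\<integral>\<^sup>+t\<in>{0..T}. ennreal ((u t w)\<^sup>2) \<partial>lborel) \<le> B w"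
    using path AE_space
  proof eventually_elim
    case (elim w)
    let ?E = "\<integral>\<^sup>+t\<in>{0..T}. ennreal ((u t w / l)\<^sup>2) \<partial>lborel"
    have "(\<integral>\<^sup>+t\<in>{0..T}. ennreal ((controlled_state x u t w - \<xi> t w)\<^sup>2) \<partial>lborel) = ?E"
      using elim(1) by (intro nn_integral_cong) (auto simp: indicator_def)
    moreover have "ennreal (1 / l\<^sup>2 / 2) * (\<integral>\<^sup>+t\<in>{0..T}. ennreal ((u t w)\<^sup>2) \<partial>lborel) = ennreal (1 / 2) * ?E"
      unfolding u_sq[OF elim(2)] mult.assoc[symmetric] using l by (simp flip: ennreal_mult)
    moreover have "ennreal (1 / 2) * ?E + ennreal (1 / 2) * ?E = ?E"
    proof -
      have "ennreal (1 / 2) + ennreal (1 / 2) = 1"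
        by (subst ennreal_plus[symmetric]) auto
      then show ?thesis unfolding distrib_right[symmetric] by (simp only: mult_1)
    qed
    ultimately show ?case using elim(1) by simp
  qed
  have "tracking_value M F T \<xi> x (1 / l\<^sup>2) \<le> tracking_cost M T \<xi> x (1 / l\<^sup>2) u"
    unfolding tracking_value_def using \<open>u \<in> controls M F T\<close> by (rule INF_lower)
  also have "\<dots> \<le> (\<integral>\<^sup>+w. B w \<partial>M)"
    unfolding tracking_cost_def using cost by (rule nn_integral_mono_AE)
  finally show ?thesis unfolding B .
qed simp

end

section \<open>Value function\<close>

lemma (in usual_filtered_prob_space) L2_modulus_le_tracking_value:
  assumes \<xi>: "progressively_measurable F T \<xi>" and \<xi>0: "(\<integral>\<^sup>+w. ennreal ((x - \<xi> 0 w)\<^sup>2) \<partial>M) < \<infinity>"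
    and \<kappa>: "0 < \<kappa>"
  shows "ennreal (1 / 12) * L2_modulus M T \<xi> (sqrt (2 * \<kappa>))
    \<le> tracking_value M F T \<xi> x \<kappa> + ennreal (sqrt 2 / 4 * sqrt \<kappa>) * (\<integral>\<^sup>+w. ennreal ((x - \<xi> 0 w)\<^sup>2) \<partial>M)"
    (is "?L \<le> _ + ?e")
proof -
  have e: "?e \<noteq> \<top>"
    using \<xi>0 by (auto simp: ennreal_mult_eq_top_iff)
  \<comment> \<open>The gap term is moved to the left so that the bound passes to the infimum over
    controls. Truncated subtraction on \<open>ennreal\<close> permits this, and the way back,
    because the gap is finite.\<close>
  have "?L - ?e \<le> tracking_cost M T \<xi> x \<kappa> u" if "u \<in> controls M F T" for u
  proof -
    have "L2_modulus M T \<xi> (sqrt (2 * \<kappa>)) \<le> 12 * (tracking_cost M T \<xi> x \<kappa> u + ?e)"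
    proof -
      have "(sqrt (2 * \<kappa>))\<^sup>2 / 2 = \<kappa>" "sqrt (2 * \<kappa>) / 4 = sqrt 2 / 4 * sqrt \<kappa>"
        using \<kappa> by (simp_all add: real_sqrt_mult power_mult_distrib)
      moreover have "progressively_measurable F T u" "0 < sqrt (2 * \<kappa>)"
        using that \<kappa> by (simp_all add: controls_def)
      ultimately show ?thesis
        using L2_modulus_le_tracking_cost[OF \<xi>, of u "sqrt (2 * \<kappa>)" x] by (simp only:)
    qed
    then have "?L \<le> ennreal (1 / 12) * (12 * (tracking_cost M T \<xi> x \<kappa> u + ?e))"
      by (intro mult_left_mono) auto
    also have "ennreal (1 / 12) * (12 * y) = y" for y
    proof -
      have "ennreal (1 / 12) * ennreal 12 = 1"
        by (subst ennreal_mult[symmetric]) auto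
      then show ?thesis by (simp add: mult.assoc[symmetric])
    qed
    finally show ?thesis
      using e by (simp add: ennreal_minus_le_iff add.commute)
  qed
  then have "?L - ?e \<le> tracking_value M F T \<xi> x \<kappa>"
    unfolding tracking_value_def by (rule INF_greatest)
  then show ?thesis
    using e by (simp add: ennreal_minus_le_iff add.commute)
qed

section \<open>Moduli of power type and asymptotic equivalence\<close>

lemma L2_modulus_ge_horizon:
  assumes "T \<le> h" "0 \<le> T"
  shows "L2_modulus M T \<xi> h = L2_modulus M T \<xi> T"
  unfolding L2_modulus_def using assms
  by (intro nn_integral_cong) (auto simp: indicator_def max_def)

lemma exp_average_L2_modulus_le:
  assumes T: "0 < T" and \<kappa>: "0 < \<kappa>" and C: "0 \<le> C" and \<alpha>: "0 < \<alpha>"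
    and up: "\<And>h. 0 < h \<Longrightarrow> h \<le> T \<Longrightarrow> L2_modulus M T \<xi> h \<le> ennreal (C * h powr \<alpha>)"
  shows "ennreal (1 / sqrt \<kappa>) *
      (\<integral>\<^sup>+h\<in>{0<..}. ennreal (exp (- h / sqrt \<kappa>)) * L2_modulus M T \<xi> h \<partial>lborel)
    \<le> ennreal (C * Gamma (\<alpha> + 1) * \<kappa> powr (\<alpha> / 2))"
proof -
  \<comment> \<open>The power bound is given up to T, but the average runs over all h > 0. Beyond T
    the modulus is constant while the power keeps growing.\<close>
  have up': "L2_modulus M T \<xi> h \<le> ennreal (C * h powr \<alpha>)" if "0 < h" for h
  proof (cases "h \<le> T")
    case False
    then have "L2_modulus M T \<xi> h \<le> ennreal (C * T powr \<alpha>)"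
      using up[of T] T L2_modulus_ge_horizon[of T h M \<xi>] by simp
    also have "\<dots> \<le> ennreal (C * h powr \<alpha>)"
      using False T \<alpha> C by (intro ennreal_leI mult_left_mono powr_mono2) auto
    finally show ?thesis .
  qed (use that up in auto)
  let ?l = "1 / sqrt \<kappa>"
  have "(\<integral>\<^sup>+h\<in>{0<..}. ennreal (exp (- h / sqrt \<kappa>)) * L2_modulus M T \<xi> h \<partial>lborel)
      \<le> (\<integral>\<^sup>+h. ennreal C * (ennreal (exp (- h * ?l)) * ennreal (h powr \<alpha>) * indicator {0<..} h) \<partial>lborel)"
  proof (intro nn_integral_mono)
    fix h :: real
    show "ennreal (exp (- h / sqrt \<kappa>)) * L2_modulus M T \<xi> h * indicator {0<..} h
      \<le> ennreal C * (ennreal (exp (- h * ?l)) * ennreal (h powr \<alpha>) * indicator {0<..} h)"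
    proof (cases "0 < h")
      case True
      then have "ennreal (exp (- h / sqrt \<kappa>)) * L2_modulus M T \<xi> h \<le> ennreal (exp (- h / sqrt \<kappa>)) * ennreal (C * h powr \<alpha>)"
        using up' by (intro mult_left_mono) auto
      then show ?thesis using True C by (simp add: ennreal_mult mult_ac)
    qed auto
  qed
  also have "\<dots> = ennreal C * ennreal (Gamma (\<alpha> + 1) * (1 / ?l) powr (\<alpha> + 1))"
    using nn_integral_exp_powr[of ?l \<alpha>] \<kappa> \<alpha> by (subst nn_integral_cmult) auto
  finally have "ennreal ?l * (\<integral>\<^sup>+h\<in>{0<..}. ennreal (exp (- h / sqrt \<kappa>)) * L2_modulus M T \<xi> h \<partial>lborel)
      \<le> ennreal ?l * (ennreal C * ennreal (Gamma (\<alpha> + 1) * (1 / ?l) powr (\<alpha> + 1)))"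
    by (rule mult_left_mono) auto
  also have "\<dots> = ennreal (?l * (C * (Gamma (\<alpha> + 1) * (1 / ?l) powr (\<alpha> + 1))))"
  proof -
    have "0 \<le> Gamma (\<alpha> + 1)" using \<alpha> Gamma_real_pos[of "\<alpha> + 1"] by simp
    then have "0 \<le> ?l" "0 \<le> Gamma (\<alpha> + 1) * (1 / ?l) powr (\<alpha> + 1)" using \<kappa> by auto
    with C show ?thesis by (metis ennreal_mult mult_nonneg_nonneg)
  qed
  also have "?l * (C * (Gamma (\<alpha> + 1) * (1 / ?l) powr (\<alpha> + 1)))
      = C * Gamma (\<alpha> + 1) * (?l * sqrt \<kappa> powr (\<alpha> + 1))"
    by simp
  also have "?l * sqrt \<kappa> powr (\<alpha> + 1) = \<kappa> powr (\<alpha> / 2)"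
  proof -
    have "sqrt \<kappa> powr \<alpha> = \<kappa> powr (\<alpha> / 2)"
      unfolding powr_half_sqrt[OF less_imp_le[OF \<kappa>], symmetric] powr_powr by simp
    then show ?thesis using \<kappa> by (simp add: powr_add)
  qed
  finally show ?thesis .
qed

text \<open>Comparison without division: for g positive and finite, quotients in
  \<open>ennreal\<close> cancel as usual.\<close>

lemma asymp_at_0I:
  assumes a: "0 < a" and b: "0 < b" and r: "0 < r"
    and "\<And>\<kappa>. 0 < \<kappa> \<Longrightarrow> \<kappa> < r \<Longrightarrow> 0 < g \<kappa> \<and> g \<kappa> < \<infinity> \<and> ennreal a * g \<kappa> \<le> f \<kappa> \<and> f \<kappa> \<le> ennreal b * g \<kappa>"
  shows "asymp_at_0 f g"
  unfolding asymp_at_0_def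
proof (intro exI conjI)
  show "\<forall>\<^sub>F \<kappa> in at_right 0. ennreal a \<le> f \<kappa> / g \<kappa> \<and> f \<kappa> / g \<kappa> \<le> ennreal b"
    unfolding eventually_at_right_field
  proof (intro exI[of _ r] conjI allI impI r)
    fix \<kappa> assume "0 < \<kappa>" "\<kappa> < r"
    from assms(4)[OF this] have g: "0 < g \<kappa>" "g \<kappa> < \<infinity>" "ennreal a * g \<kappa> \<le> f \<kappa>" "f \<kappa> \<le> ennreal b * g \<kappa>"
      by blast+
    have cancel: "y * g \<kappa> / g \<kappa> = y" for y
      using g(1,2) by (intro ennreal_mult_divide_eq) auto
    show "ennreal a \<le> f \<kappa> / g \<kappa>"
      using divide_right_mono_ennreal[OF g(3), of "g \<kappa>"] unfolding cancel .
    show "f \<kappa> / g \<kappa> \<le> ennreal b"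
      using divide_right_mono_ennreal[OF g(4), of "g \<kappa>"] unfolding cancel .
  qed
qed (use a b in auto)

theorem proposition2p4:
  fixes M :: "'a measure" and F :: "real \<Rightarrow> 'a measure" and T x :: real
    and \<xi> :: "real \<Rightarrow> 'a \<Rightarrow> real"
  assumes "usual_filtered_prob_space M F T"
    and "progressively_measurable F T \<xi>"
    and "(\<integral>\<^sup>+w. ennreal ((\<xi> 0 w)\<^sup>2) \<partial>M) < \<infinity>"
    and "(\<integral>\<^sup>+w. (\<integral>\<^sup>+t\<in>{0..T}. ennreal ((\<xi> t w)\<^sup>2) \<partial>lborel) \<partial>M) < \<infinity>"
  shows
    "(\<forall>\<kappa>. 0 < \<kappa> \<and> \<kappa> \<le> T\<^sup>2 / 2 \<longrightarrow>
        enn2ereal (tracking_value M F T \<xi> x \<kappa>) \<ge>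
          ereal (1 / 12) * enn2ereal (L2_modulus M T \<xi> (sqrt (2 * \<kappa>)))
          - ereal (sqrt 2 / 4 * sqrt \<kappa>) * enn2ereal (\<integral>\<^sup>+w. ennreal ((x - \<xi> 0 w)\<^sup>2) \<partial>M)) \<and>
     ((AE w in M. x = \<xi> 0 w) \<longrightarrow>
        (\<forall>\<kappa>. 0 < \<kappa> \<and> \<kappa> \<le> T\<^sup>2 / 2 \<longrightarrow>
          ennreal (1 / 12) * L2_modulus M T \<xi> (sqrt (2 * \<kappa>)) \<le> tracking_value M F T \<xi> x \<kappa> \<and>
          tracking_value M F T \<xi> x \<kappa> \<le>
            ennreal (1 / sqrt \<kappa>) *
              (\<integral>\<^sup>+h\<in>{0<..}. ennreal (exp (- h / sqrt \<kappa>)) * L2_modulus M T \<xi> h \<partial>lborel))) \<and>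
     ((AE w in M. x = \<xi> 0 w) \<longrightarrow>
        (\<forall>c C \<alpha>. 0 < c \<and> 0 < C \<and> 0 < \<alpha> \<and>
          (\<forall>h. 0 < h \<and> h \<le> T \<longrightarrow>
            ennreal (c * h powr \<alpha>) \<le> L2_modulus M T \<xi> h \<and>
            L2_modulus M T \<xi> h \<le> ennreal (C * h powr \<alpha>)) \<longrightarrow>
          (\<forall>\<kappa>. 0 < \<kappa> \<and> \<kappa> \<le> T\<^sup>2 / 2 \<longrightarrow>
            ennreal (c * 2 powr (\<alpha> / 2) / 12 * \<kappa> powr (\<alpha> / 2)) \<le> tracking_value M F T \<xi> x \<kappa> \<and>
            tracking_value M F T \<xi> x \<kappa> \<le> ennreal (C * Gamma (\<alpha> + 1) * \<kappa> powr (\<alpha> / 2))) \<and>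
          asymp_at_0 (\<lambda>\<kappa>. tracking_value M F T \<xi> x \<kappa>) (\<lambda>\<kappa>. ennreal (\<kappa> powr (\<alpha> / 2))) \<and>
          asymp_at_0 (\<lambda>\<kappa>. ennreal (\<kappa> powr (\<alpha> / 2))) (\<lambda>\<kappa>. L2_modulus M T \<xi> (sqrt \<kappa>))))"
proof -
  interpret usual_filtered_prob_space M F T by fact
  let ?v = "tracking_value M F T \<xi> x" and ?\<omega> = "L2_modulus M T \<xi>"
  let ?e = "\<integral>\<^sup>+w. ennreal ((x - \<xi> 0 w)\<^sup>2) \<partial>M"
  note \<xi> = assms(2)
  have [measurable]: "\<xi> 0 \<in> borel_measurable M"
  proof -
    have "(\<lambda>w. stopped T \<xi> 0 w) \<in> borel_measurable M"
      using measurable_compose[OF measurable_Pair1' measurable_stopped[OF \<xi>]] by simp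
    then show ?thesis using T_pos by (simp add: stopped_eq)
  qed
  have e: "?e < \<infinity>"
  proof -
    have "?e \<le> (\<integral>\<^sup>+w. ennreal (2 * x\<^sup>2) + ennreal 2 * ennreal ((\<xi> 0 w)\<^sup>2) \<partial>M)"
    proof (intro nn_integral_mono)
      fix w
      have "(x - \<xi> 0 w)\<^sup>2 \<le> 2 * x\<^sup>2 + 2 * (\<xi> 0 w)\<^sup>2"
        using zero_le_power2[of "x + \<xi> 0 w"] by (simp add: power2_eq_square algebra_simps)
      then show "ennreal ((x - \<xi> 0 w)\<^sup>2) \<le> ennreal (2 * x\<^sup>2) + ennreal 2 * ennreal ((\<xi> 0 w)\<^sup>2)"
        by (simp flip: ennreal_plus ennreal_mult add: ennreal_leI del: ennreal_numeral)
    qed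
    also have "\<dots> < \<infinity>"
      using assms(3) by (simp add: nn_integral_add nn_integral_cmult emeasure_space_1 ennreal_mult_less_top del: ennreal_numeral)
    finally show ?thesis .
  qed
  have lower: "ennreal (1 / 12) * ?\<omega> (sqrt (2 * \<kappa>)) \<le> ?v \<kappa> + ennreal (sqrt 2 / 4 * sqrt \<kappa>) * ?e"
    if "0 < \<kappa>" for \<kappa>
    using L2_modulus_le_tracking_value[OF \<xi> e that] .
  \<comment> \<open>The difference may be negative, so it lives in \<open>ereal\<close>; finiteness
    of the gap justifies moving it across the inequality.\<close>
  have first: "ereal (1 / 12) * enn2ereal (?\<omega> (sqrt (2 * \<kappa>))) - ereal (sqrt 2 / 4 * sqrt \<kappa>) * enn2ereal ?e
      \<le> enn2ereal (?v \<kappa>)" if "0 < \<kappa>" for \<kappa>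
  proof -
    have "enn2ereal (ennreal (1 / 12) * ?\<omega> (sqrt (2 * \<kappa>)))
        \<le> enn2ereal (?v \<kappa> + ennreal (sqrt 2 / 4 * sqrt \<kappa>) * ?e)"
      using lower[OF that] by (simp only: less_eq_ennreal.rep_eq)
    then have "ereal (1 / 12) * enn2ereal (?\<omega> (sqrt (2 * \<kappa>)))
        \<le> enn2ereal (?v \<kappa>) + ereal (sqrt 2 / 4 * sqrt \<kappa>) * enn2ereal ?e"
      using that by (simp only: times_ennreal.rep_eq plus_ennreal.rep_eq enn2ereal_ennreal) simp
    moreover have fin: "\<bar>ereal (sqrt 2 / 4 * sqrt \<kappa>) * enn2ereal ?e\<bar> \<noteq> \<infinity>"
      using e by (cases ?e) auto
    ultimately show ?thesis
      using iffD2[OF ereal_minus_le[OF fin]] by simp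
  qed
  have second: "ennreal (1 / 12) * ?\<omega> (sqrt (2 * \<kappa>)) \<le> ?v \<kappa>"
    "?v \<kappa> \<le> ennreal (1 / sqrt \<kappa>) *
      (\<integral>\<^sup>+h\<in>{0<..}. ennreal (exp (- h / sqrt \<kappa>)) * ?\<omega> h \<partial>lborel)"
    if start: "AE w in M. x = \<xi> 0 w" and \<kappa>: "0 < \<kappa>" for \<kappa>
  proof -
    have "?e = (\<integral>\<^sup>+w. 0 \<partial>M)"
      using start by (intro nn_integral_cong_AE) auto
    then show "ennreal (1 / 12) * ?\<omega> (sqrt (2 * \<kappa>)) \<le> ?v \<kappa>"
      using lower[OF \<kappa>] by simp
    show "?v \<kappa> \<le> ennreal (1 / sqrt \<kappa>) *
      (\<integral>\<^sup>+h\<in>{0<..}. ennreal (exp (- h / sqrt \<kappa>)) * ?\<omega> h \<partial>lborel)"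
      using tracking_value_le[OF \<xi> start assms(4), of "1 / sqrt \<kappa>"] \<kappa> by (simp add: power_divide)
  qed
  have third: "(\<forall>\<kappa>. 0 < \<kappa> \<and> \<kappa> \<le> T\<^sup>2 / 2 \<longrightarrow>
        ennreal (c * 2 powr (\<alpha> / 2) / 12 * \<kappa> powr (\<alpha> / 2)) \<le> ?v \<kappa> \<and>
        ?v \<kappa> \<le> ennreal (C * Gamma (\<alpha> + 1) * \<kappa> powr (\<alpha> / 2))) \<and>
      asymp_at_0 ?v (\<lambda>\<kappa>. ennreal (\<kappa> powr (\<alpha> / 2))) \<and>
      asymp_at_0 (\<lambda>\<kappa>. ennreal (\<kappa> powr (\<alpha> / 2))) (\<lambda>\<kappa>. ?\<omega> (sqrt \<kappa>))"
    if start: "AE w in M. x = \<xi> 0 w" and c: "0 < c" and C: "0 < C" and \<alpha>: "0 < \<alpha>"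
      and lo: "\<And>h. 0 < h \<Longrightarrow> h \<le> T \<Longrightarrow> ennreal (c * h powr \<alpha>) \<le> ?\<omega> h"
      and up: "\<And>h. 0 < h \<Longrightarrow> h \<le> T \<Longrightarrow> ?\<omega> h \<le> ennreal (C * h powr \<alpha>)" for c C \<alpha>
  proof (intro conjI)
    \<comment> \<open>The range of \<kappa> keeps the delay sqrt (2 * \<kappa>) within the horizon,
      where the lower power bound is available.\<close>
    have sqrt_le: "sqrt (2 * \<kappa>) \<le> T" if "\<kappa> \<le> T\<^sup>2 / 2" for \<kappa>
      using that T_pos by (intro real_le_lsqrt) auto
    have sqrt_powr: "sqrt y powr \<alpha> = y powr (\<alpha> / 2)" if "0 < y" for y
      unfolding powr_half_sqrt[OF less_imp_le[OF that], symmetric] powr_powr by simp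
    have v: "ennreal (c * 2 powr (\<alpha> / 2) / 12 * \<kappa> powr (\<alpha> / 2)) \<le> ?v \<kappa>"
      "?v \<kappa> \<le> ennreal (C * Gamma (\<alpha> + 1) * \<kappa> powr (\<alpha> / 2))"
      if \<kappa>: "0 < \<kappa>" "\<kappa> \<le> T\<^sup>2 / 2" for \<kappa>
    proof -
      have "ennreal (c * 2 powr (\<alpha> / 2) / 12 * \<kappa> powr (\<alpha> / 2))
          = ennreal (1 / 12 * (c * sqrt (2 * \<kappa>) powr \<alpha>))"
        using \<kappa> sqrt_powr[of "2 * \<kappa>"] by (simp add: powr_mult mult.assoc)
      also have "\<dots> = ennreal (1 / 12) * ennreal (c * sqrt (2 * \<kappa>) powr \<alpha>)"
        using c by (intro ennreal_mult) auto
      also have "\<dots> \<le> ennreal (1 / 12) * ?\<omega> (sqrt (2 * \<kappa>))"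
        using \<kappa> sqrt_le by (intro mult_left_mono lo) auto
      also have "\<dots> \<le> ?v \<kappa>"
        by (rule second(1)[OF start \<kappa>(1)])
      finally show "ennreal (c * 2 powr (\<alpha> / 2) / 12 * \<kappa> powr (\<alpha> / 2)) \<le> ?v \<kappa>" .
      show "?v \<kappa> \<le> ennreal (C * Gamma (\<alpha> + 1) * \<kappa> powr (\<alpha> / 2))"
        using second(2)[OF start \<kappa>(1)] exp_average_L2_modulus_le[OF T_pos \<kappa>(1) less_imp_le[OF C] \<alpha> up]
        by (rule order_trans)
    qed
    then show "\<forall>\<kappa>. 0 < \<kappa> \<and> \<kappa> \<le> T\<^sup>2 / 2 \<longrightarrow>
        ennreal (c * 2 powr (\<alpha> / 2) / 12 * \<kappa> powr (\<alpha> / 2)) \<le> ?v \<kappa> \<and>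
        ?v \<kappa> \<le> ennreal (C * Gamma (\<alpha> + 1) * \<kappa> powr (\<alpha> / 2))"
      by blast
    have r: "0 < T\<^sup>2 / 2" using T_pos by simp
    have G: "0 < Gamma (\<alpha> + 1)" using \<alpha> by (simp add: Gamma_real_pos)
    show "asymp_at_0 ?v (\<lambda>\<kappa>. ennreal (\<kappa> powr (\<alpha> / 2)))"
    proof (rule asymp_at_0I[OF _ _ r])
      show "0 < c * 2 powr (\<alpha> / 2) / 12" "0 < C * Gamma (\<alpha> + 1)"
        using c C G by simp_all
      show "0 < ennreal (\<kappa> powr (\<alpha> / 2)) \<and> ennreal (\<kappa> powr (\<alpha> / 2)) < \<infinity> \<and>
          ennreal (c * 2 powr (\<alpha> / 2) / 12) * ennreal (\<kappa> powr (\<alpha> / 2)) \<le> ?v \<kappa> \<and>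
          ?v \<kappa> \<le> ennreal (C * Gamma (\<alpha> + 1)) * ennreal (\<kappa> powr (\<alpha> / 2))"
        if "0 < \<kappa>" "\<kappa> < T\<^sup>2 / 2" for \<kappa>
        using v[of \<kappa>] that c C G by (simp flip: ennreal_mult)
    qed
    show "asymp_at_0 (\<lambda>\<kappa>. ennreal (\<kappa> powr (\<alpha> / 2))) (\<lambda>\<kappa>. ?\<omega> (sqrt \<kappa>))"
    proof (rule asymp_at_0I[OF _ _ r])
      \<comment> \<open>Here the modulus is the denominator, so its upper constant C yields the
        lower bound of the quotient and c the upper one.\<close>
      show "0 < 1 / C" "0 < 1 / c" using c C by simp_all
      fix \<kappa> :: real assume \<kappa>: "0 < \<kappa>" "\<kappa> < T\<^sup>2 / 2"
      then have "sqrt \<kappa> \<le> sqrt (2 * \<kappa>)" "sqrt (2 * \<kappa>) \<le> T"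
        by (simp_all only: real_sqrt_le_iff sqrt_le less_imp_le)
      then have "sqrt \<kappa> \<le> T" by (rule order_trans)
      then have \<omega>: "ennreal (c * \<kappa> powr (\<alpha> / 2)) \<le> ?\<omega> (sqrt \<kappa>)" "?\<omega> (sqrt \<kappa>) \<le> ennreal (C * \<kappa> powr (\<alpha> / 2))"
        using \<kappa> lo[of "sqrt \<kappa>"] up[of "sqrt \<kappa>"] by (simp_all add: sqrt_powr)
      have "0 < ennreal (c * \<kappa> powr (\<alpha> / 2))" using c \<kappa> by simp
      then have "0 < ?\<omega> (sqrt \<kappa>)" using \<omega>(1) by (rule less_le_trans)
      moreover have "?\<omega> (sqrt \<kappa>) < \<infinity>"
        using \<omega>(2) by (rule le_less_trans) simp
      moreover have "ennreal (1 / C) * ?\<omega> (sqrt \<kappa>) \<le> ennreal (\<kappa> powr (\<alpha> / 2))"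
        using mult_left_mono[OF \<omega>(2), of "ennreal (1 / C)"] C by (simp flip: ennreal_mult)
      moreover have "ennreal (\<kappa> powr (\<alpha> / 2)) \<le> ennreal (1 / c) * ?\<omega> (sqrt \<kappa>)"
        using mult_left_mono[OF \<omega>(1), of "ennreal (1 / c)"] c by (simp flip: ennreal_mult)
      ultimately show "0 < ?\<omega> (sqrt \<kappa>) \<and> ?\<omega> (sqrt \<kappa>) < \<infinity> \<and>
          ennreal (1 / C) * ?\<omega> (sqrt \<kappa>) \<le> ennreal (\<kappa> powr (\<alpha> / 2)) \<and>
          ennreal (\<kappa> powr (\<alpha> / 2)) \<le> ennreal (1 / c) * ?\<omega> (sqrt \<kappa>)"
        by blast
    qed
  qed
  show ?thesis
  proof (rule conjI[OF _ conjI]; intro allI impI; elim conjE)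
    fix \<kappa> :: real assume "0 < \<kappa>"
    then show "ereal (1 / 12) * enn2ereal (?\<omega> (sqrt (2 * \<kappa>))) - ereal (sqrt 2 / 4 * sqrt \<kappa>) * enn2ereal ?e
      \<le> enn2ereal (?v \<kappa>)" by (rule first)
  qed (rule conjI[OF second] third; simp)+
qed

end
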